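(* Fix distinct $A_1,A_2\in\{(123),(124),(134),(234)\}$, non-negative integers $r_{A_1},r_{A_2}$, an integer $k\ge0$, and $\zeta>0$. The closure of the moduli space $\mathfrak M_{\boldsymbol r_{A_1,A_2},k}^{\mathsf T_{A_1,A_2}}$ of $\mathsf T_{A_1,A_2}$-invariant tetrahedron instantons of type $\boldsymbol r_{A_1,A_2}=(r_{A_1},r_{A_2},0,0)$ and charge $k$ is compact.
   Context: For $A\in\{(123),(124),(134),(234)\}$ let $\bar A$ be the element of $\{1,2,3,4\}$ not in $A$, and write $A_1\cap A_2=\{a_1,a_2\}$. Let $V$, $W_{A_1}$, $W_{A_2}$ be Hermitian vector spaces of complex dimensions $k$, $r_{A_1}$, $r_{A_2}$. ADHM data are tuples $(B_a,I_{A_1},I_{A_2})_{a=1,\dots,4}$ with $B_a\in\mathrm{End}_{\mathbb C}(V)$, $I_{A_i}\in\mathrm{Hom}_{\mathbb C}(W_{A_i},V)$. The ADHM equations are $$[B_a,B_b]-\tfrac12\sum_{c,d}\varepsilon_{abcd}[B_c^\dagger,B_d^\dagger]=0\ \ (1\le a<b\le 4),\qquad \sum_{a=1}^4[B_a,B_a^\dagger]+I_{A_1}I_{A_1}^\dagger+I_{A_2}I_{A_2}^\dagger=\zeta\,\mathrm{id}_V,$$ $$B_{\bar A_1}I_{A_1}=0,\qquad B_{\bar A_2}I_{A_2}=0,$$ where $\varepsilon_{abcd}$ is the Levi-Civita symbol with $\varepsilon_{1234}=1$. The group $U(k)=U(V)$ acts by $g\cdot(B_a,I_{A_1},I_{A_2})=(gB_ag^{-1},gI_{A_1},gI_{A_2})$.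 The moduli space $\mathfrak M_{\boldsymbol r_{A_1,A_2},k}$ of tetrahedron instantons of type $\boldsymbol r_{A_1,A_2}$ and charge $k$ is the set of $U(k)$-orbits of solutions, with the topology induced by the Frobenius norm on the affine space of ADHM data (closures are taken in the orbit space of this affine space by $U(k)$). The torus $\mathsf T_{A_1,A_2}=U(1)^{r_{A_1}}\times U(1)^{r_{A_2}}\times U(1)^{2}$ acts on ADHM data, and hence on the moduli space, by $$B_{a_1}\mapsto t_1^{-1}B_{a_1},\quad B_{a_2}\mapsto t_1^{-1}B_{a_2},\quad B_{\bar A_2}\mapsto t_2^{-1}B_{\bar A_2},\quad B_{\bar A_1}\mapsto t_1^{2}t_2\,B_{\bar A_1},\quad I_{A_1}\mapsto I_{A_1}h_1,\quad I_{A_2}\mapsto I_{A_2}h_2,$$ where $(t_1,t_2)\in U(1)^2$ and $h_i\in U(1)^{r_{A_i}}$ is a diagonal unitary matrix acting on $W_{A_i}\cong\mathbb C^{r_{A_i}}$. $\mathfrak M_{\boldsymbol r_{A_1,A_2},k}^{\mathsf T_{A_1,A_2}}$ is the set of points of the moduli space fixed by $\mathsf T_{A_1,A_2}$. *)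

theory Defs
  imports "HOL-Analysis.Analysis" "Jordan_Normal_Form.Schur_Decomposition"
begin

text \<open>Indices are the elements of \<open>{1..4} :: nat set\<close>, and a triple \<open>(abc)\<close> is the
  three-element set \<open>{a, b, c}\<close>. The Hermitian spaces \<open>V\<close>, \<open>W\<^sub>1\<close>, \<open>W\<^sub>2\<close> are the standard
  \<open>\<complex>\<^sup>k\<close>, \<open>\<complex>\<^sup>r\<close>, \<open>\<complex>\<^sup>s\<close>, i.e. orthonormal bases have been chosen; dimension 0 is allowed.\<close>

definition triples :: "nat set set" where
  "triples = {{1,2,3}, {1,2,4}, {1,3,4}, {2,3,4}}"

definition compl_idx :: "nat set \<Rightarrow> nat" where
  "compl_idx A = (THE a. a \<in> {1..4} \<and> a \<notin> A)"

text \<open>The sign of the Vandermonde product is the sign of the permutation when the indices are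
  distinct, and 0 otherwise.\<close>

definition levi_civita :: "nat \<Rightarrow> nat \<Rightarrow> nat \<Rightarrow> nat \<Rightarrow> int" where
  "levi_civita a b c d = sgn
     ((int b - int a) * (int c - int a) * (int d - int a) *
      (int c - int b) * (int d - int b) * (int d - int c))"

lemma levi_civita_1234: "levi_civita 1 2 3 4 = 1"
  by (simp add: levi_civita_def)

lemma levi_civita_swap:
  "levi_civita b a c d = - levi_civita a b c d"
  "levi_civita a c b d = - levi_civita a b c d"
  "levi_civita a b d c = - levi_civita a b c d"
proof -
  have antisym: "sgn x = - sgn y" if "x = - y" for x y :: int
    using that by (simp add: sgn_minus)
  show "levi_civita b a c d = - levi_civita a b c d"
    "levi_civita a c b d = - levi_civita a b c d"
    "levi_civita a b d c = - levi_civita a b c d"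
    unfolding levi_civita_def by (rule antisym, simp add: algebra_simps)+
qed

definition mat_sum :: "nat \<Rightarrow> nat \<Rightarrow> ('i \<Rightarrow> complex mat) \<Rightarrow> 'i set \<Rightarrow> complex mat" where
  "mat_sum n m f S = mat n m (\<lambda>ij. \<Sum>s\<in>S. f s $$ ij)"

definition commutator :: "complex mat \<Rightarrow> complex mat \<Rightarrow> complex mat" where
  "commutator X Y = X * Y - Y * X"

definition unitary_group :: "nat \<Rightarrow> complex mat set" where
  "unitary_group n = {g \<in> carrier_mat n n. mat_adjoint g * g = 1\<^sub>m n \<and> g * mat_adjoint g = 1\<^sub>m n}"

type_synonym adhm = "(nat \<Rightarrow> complex mat) \<times> complex mat \<times> complex mat"

definition adhm_data :: "nat \<Rightarrow> nat \<Rightarrow> nat \<Rightarrow> adhm set" where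
  "adhm_data k r s = ({1..4} \<rightarrow>\<^sub>E carrier_mat k k) \<times> carrier_mat k r \<times> carrier_mat k s"

definition adhm_solutions :: "nat set \<Rightarrow> nat set \<Rightarrow> nat \<Rightarrow> nat \<Rightarrow> nat \<Rightarrow> real \<Rightarrow> adhm set" where
  "adhm_solutions A1 A2 k r s \<zeta> = {(B, I1, I2) \<in> adhm_data k r s.
     (\<forall>a\<in>{1..4}. \<forall>b\<in>{1..4}. a < b \<longrightarrow>
        commutator (B a) (B b)
        - (1/2) \<cdot>\<^sub>m mat_sum k k
            (\<lambda>(c, d). of_int (levi_civita a b c d) \<cdot>\<^sub>m
               commutator (mat_adjoint (B c)) (mat_adjoint (B d)))
            ({1..4} \<times> {1..4})
        = 0\<^sub>m k k) \<and>
     mat_sum k k (\<lambda>a. commutator (B a) (mat_adjoint (B a))) {1..4}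
        + I1 * mat_adjoint I1 + I2 * mat_adjoint I2 = complex_of_real \<zeta> \<cdot>\<^sub>m 1\<^sub>m k \<and>
     B (compl_idx A1) * I1 = 0\<^sub>m k r \<and>
     B (compl_idx A2) * I2 = 0\<^sub>m k s}"

text \<open>For unitary \<open>g\<close> the inverse is the adjoint.\<close>

definition gauge_act :: "complex mat \<Rightarrow> adhm \<Rightarrow> adhm" where
  "gauge_act g = (\<lambda>(B, I1, I2). (\<lambda>a\<in>{1..4}. g * B a * mat_adjoint g, g * I1, g * I2))"

definition gauge_orbit :: "nat \<Rightarrow> adhm \<Rightarrow> adhm set" where
  "gauge_orbit k x = (\<lambda>g. gauge_act g x) ` unitary_group k"

definition frobenius_dist :: "nat \<Rightarrow> nat \<Rightarrow> complex mat \<Rightarrow> complex mat \<Rightarrow> real" where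
  "frobenius_dist n m X Y = L2_set (\<lambda>ij. cmod (X $$ ij - Y $$ ij)) ({..<n} \<times> {..<m})"

definition adhm_dist :: "nat \<Rightarrow> nat \<Rightarrow> nat \<Rightarrow> adhm \<Rightarrow> adhm \<Rightarrow> real" where
  "adhm_dist k r s = (\<lambda>(B, I1, I2) (B', I1', I2').
     sqrt ((\<Sum>a\<in>{1..4}. (frobenius_dist k k (B a) (B' a))\<^sup>2)
           + (frobenius_dist k r I1 I1')\<^sup>2 + (frobenius_dist k s I2 I2')\<^sup>2))"

definition adhm_topology :: "nat \<Rightarrow> nat \<Rightarrow> nat \<Rightarrow> adhm topology" where
  "adhm_topology k r s = Metric_space.mtopology (adhm_data k r s) (adhm_dist k r s)"

text \<open>The quotient topology on the set of \<open>U(k)\<close>-orbits of all ADHM data.\<close>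

definition orbit_topology :: "nat \<Rightarrow> nat \<Rightarrow> nat \<Rightarrow> adhm set topology" where
  "orbit_topology k r s = topology (\<lambda>U. U \<subseteq> gauge_orbit k ` adhm_data k r s \<and>
     openin (adhm_topology k r s) {x \<in> adhm_data k r s. gauge_orbit k x \<in> U})"

definition moduli_space ::
    "nat set \<Rightarrow> nat set \<Rightarrow> nat \<Rightarrow> nat \<Rightarrow> nat \<Rightarrow> real \<Rightarrow> adhm set set" where
  "moduli_space A1 A2 k r s \<zeta> = gauge_orbit k ` adhm_solutions A1 A2 k r s \<zeta>"

type_synonym torus_elem = "complex \<times> complex \<times> complex mat \<times> complex mat"

definition torus :: "nat \<Rightarrow> nat \<Rightarrow> torus_elem set" where
  "torus r s = {(t1, t2, h1, h2). cmod t1 = 1 \<and> cmod t2 = 1 \<and>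
     h1 \<in> unitary_group r \<and> diagonal_mat h1 \<and> h2 \<in> unitary_group s \<and> diagonal_mat h2}"

definition torus_weight :: "nat set \<Rightarrow> nat set \<Rightarrow> complex \<Rightarrow> complex \<Rightarrow> nat \<Rightarrow> complex" where
  "torus_weight A1 A2 t1 t2 a =
     (if a \<in> A1 \<inter> A2 then inverse t1
      else if a = compl_idx A2 then inverse t2
      else t1\<^sup>2 * t2)"

definition torus_act :: "nat set \<Rightarrow> nat set \<Rightarrow> torus_elem \<Rightarrow> adhm \<Rightarrow> adhm" where
  "torus_act A1 A2 = (\<lambda>(t1, t2, h1, h2) (B, I1, I2).
     (\<lambda>a\<in>{1..4}. torus_weight A1 A2 t1 t2 a \<cdot>\<^sub>m B a, I1 * h1, I2 * h2))"

text \<open>The torus action commutes with the gauge action, so the induced action on orbits is the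
  image of the orbit.\<close>

definition torus_fixed_moduli ::
    "nat set \<Rightarrow> nat set \<Rightarrow> nat \<Rightarrow> nat \<Rightarrow> nat \<Rightarrow> real \<Rightarrow> adhm set set" where
  "torus_fixed_moduli A1 A2 k r s \<zeta> =
     {p \<in> moduli_space A1 A2 k r s \<zeta>. \<forall>t\<in>torus r s. torus_act A1 A2 t ` p = p}"

lemma compl_idx_simps:
  "compl_idx {1,2,3} = 4" "compl_idx {1,2,4} = 3" "compl_idx {1,3,4} = 2" "compl_idx {2,3,4} = 1"
  unfolding compl_idx_def by (rule the_equality; auto)+

lemma frobenius_dist_triangle:
  "frobenius_dist n m X Z \<le> frobenius_dist n m X Y + frobenius_dist n m Y Z"
proof -
  let ?S = "{..<n} \<times> {..<m}"
  have "L2_set (\<lambda>ij. cmod (X $$ ij - Z $$ ij)) ?S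
      \<le> L2_set (\<lambda>ij. cmod (X $$ ij - Y $$ ij) + cmod (Y $$ ij - Z $$ ij)) ?S"
    by (rule L2_set_mono)
      (use norm_triangle_ineq[of "X $$ ij - Y $$ ij" "Y $$ ij - Z $$ ij" for ij] in auto)
  also have "\<dots> \<le> L2_set (\<lambda>ij. cmod (X $$ ij - Y $$ ij)) ?S
                + L2_set (\<lambda>ij. cmod (Y $$ ij - Z $$ ij)) ?S"
    by (rule L2_set_triangle_ineq)
  finally show ?thesis by (simp add: frobenius_dist_def)
qed

lemma frobenius_dist_nonneg: "0 \<le> frobenius_dist n m X Y"
  by (simp add: frobenius_dist_def)

lemma frobenius_dist_commute: "frobenius_dist n m X Y = frobenius_dist n m Y X"
  by (simp add: frobenius_dist_def norm_minus_commute)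

lemma frobenius_dist_0_iff:
  assumes "X \<in> carrier_mat n m" "Y \<in> carrier_mat n m"
  shows "frobenius_dist n m X Y = 0 \<longleftrightarrow> X = Y"
  using assms by (auto simp: frobenius_dist_def L2_set_eq_0_iff)

lemma adhm_dist_eq:
  "adhm_dist k r s (B, I1, I2) (B', I1', I2') =
   sqrt ((sqrt ((L2_set (\<lambda>a. frobenius_dist k k (B a) (B' a)) {1..4})\<^sup>2
                + (frobenius_dist k r I1 I1')\<^sup>2))\<^sup>2
         + (frobenius_dist k s I2 I2')\<^sup>2)"
  by (simp add: adhm_dist_def L2_set_def sum_nonneg)

lemma Metric_space_adhm: "Metric_space (adhm_data k r s) (adhm_dist k r s)"
proof
  fix x y :: adhm
  show "0 \<le> adhm_dist k r s x y"
    by (cases x; cases y) (simp add: adhm_dist_eq)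
  obtain B I1 I2 where x: "x = (B, I1, I2)" by (rule prod_cases3)
  obtain B' I1' I2' where y: "y = (B', I1', I2')" by (rule prod_cases3)
  show "adhm_dist k r s x y = adhm_dist k r s y x"
    by (simp add: x y adhm_dist_def frobenius_dist_commute[of k k "B _"]
        frobenius_dist_commute[of k r I1] frobenius_dist_commute[of k s I2])
next
  fix x y :: adhm
  assume x: "x \<in> adhm_data k r s" and y: "y \<in> adhm_data k r s"
  obtain B I1 I2 where xB: "x = (B, I1, I2)" by (rule prod_cases3)
  obtain B' I1' I2' where yB: "y = (B', I1', I2')" by (rule prod_cases3)
  have c: "B \<in> {1..4} \<rightarrow>\<^sub>E carrier_mat k k" "B' \<in> {1..4} \<rightarrow>\<^sub>E carrier_mat k k"
    "I1 \<in> carrier_mat k r" "I1' \<in> carrier_mat k r" "I2 \<in> carrier_mat k s" "I2' \<in> carrier_mat k s"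
    using x y by (auto simp: xB yB adhm_data_def)
  have "adhm_dist k r s x y = 0 \<longleftrightarrow> (\<forall>a\<in>{1..4}. frobenius_dist k k (B a) (B' a) = 0) \<and>
      frobenius_dist k r I1 I1' = 0 \<and> frobenius_dist k s I2 I2' = 0"
    unfolding xB yB adhm_dist_eq
    by (simp del: One_nat_def add: add_nonneg_eq_0_iff L2_set_eq_0_iff)
  also have "\<dots> \<longleftrightarrow> (\<forall>a\<in>{1..4}. B a = B' a) \<and> I1 = I1' \<and> I2 = I2'"
    using frobenius_dist_0_iff[OF c(3,4)] frobenius_dist_0_iff[OF c(5,6)]
      frobenius_dist_0_iff[OF PiE_mem[OF c(1)] PiE_mem[OF c(2)]] by simp
  also have "(\<forall>a\<in>{1..4}. B a = B' a) \<longleftrightarrow> B = B'"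
    using PiE_ext[OF c(1,2)] by blast
  finally show "adhm_dist k r s x y = 0 \<longleftrightarrow> x = y" by (simp add: xB yB)
next
  fix x y z :: adhm
  obtain B I1 I2 where x: "x = (B, I1, I2)" by (rule prod_cases3)
  obtain B' I1' I2' where y: "y = (B', I1', I2')" by (rule prod_cases3)
  obtain B'' I1'' I2'' where z: "z = (B'', I1'', I2'')" by (rule prod_cases3)
  let ?l = "\<lambda>B B'. L2_set (\<lambda>a. frobenius_dist k k (B a) (B' a)) {1..4::nat}"
  have "?l B B'' \<le> L2_set (\<lambda>a. frobenius_dist k k (B a) (B' a) + frobenius_dist k k (B' a) (B'' a)) {1..4}"
    by (intro L2_set_mono frobenius_dist_triangle frobenius_dist_nonneg)
  also have "\<dots> \<le> ?l B B' + ?l B' B''" by (rule L2_set_triangle_ineq)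
  finally have l: "?l B B'' \<le> ?l B B' + ?l B' B''" .
  have key: "sqrt (u\<^sup>2 + v\<^sup>2) \<le> sqrt (p\<^sup>2 + q\<^sup>2) + sqrt (p'\<^sup>2 + q'\<^sup>2)"
    if "u \<le> p + p'" "v \<le> q + q'" "0 \<le> u" "0 \<le> v" for u v p q p' q' :: real
  proof -
    have "sqrt (u\<^sup>2 + v\<^sup>2) \<le> sqrt ((p + p')\<^sup>2 + (q + q')\<^sup>2)"
      using that by (intro real_sqrt_le_mono add_mono power_mono)
    also have "\<dots> \<le> sqrt (p\<^sup>2 + q\<^sup>2) + sqrt (p'\<^sup>2 + q'\<^sup>2)"
      by (rule real_sqrt_sum_squares_triangle_ineq)
    finally show ?thesis .
  qed
  show "adhm_dist k r s x z \<le> adhm_dist k r s x y + adhm_dist k r s y z"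
    unfolding x y z adhm_dist_eq
    by (intro key l frobenius_dist_triangle) (simp_all add: frobenius_dist_nonneg)
qed

lemma topspace_adhm_topology: "topspace (adhm_topology k r s) = adhm_data k r s"
  by (simp add: adhm_topology_def Metric_space.topspace_mtopology[OF Metric_space_adhm])

lemma openin_orbit_topology:
  "openin (orbit_topology k r s) U \<longleftrightarrow> U \<subseteq> gauge_orbit k ` adhm_data k r s \<and>
     openin (adhm_topology k r s) {x \<in> adhm_data k r s. gauge_orbit k x \<in> U}"
proof -
  let ?q = "gauge_orbit k" and ?D = "adhm_data k r s" and ?T = "adhm_topology k r s"
  have "istopology (\<lambda>U. U \<subseteq> ?q ` ?D \<and> openin ?T {x \<in> ?D. ?q x \<in> U})"
    unfolding istopology_def
  proof (intro conjI allI impI)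
    fix S T assume "S \<subseteq> ?q ` ?D \<and> openin ?T {x \<in> ?D. ?q x \<in> S}"
      "T \<subseteq> ?q ` ?D \<and> openin ?T {x \<in> ?D. ?q x \<in> T}"
    moreover have "{x \<in> ?D. ?q x \<in> S \<inter> T} = {x \<in> ?D. ?q x \<in> S} \<inter> {x \<in> ?D. ?q x \<in> T}" by auto
    ultimately show "S \<inter> T \<subseteq> ?q ` ?D" "openin ?T {x \<in> ?D. ?q x \<in> S \<inter> T}"
      by auto
  next
    fix \<K> assume K: "\<forall>S\<in>\<K>. S \<subseteq> ?q ` ?D \<and> openin ?T {x \<in> ?D. ?q x \<in> S}"
    then show "\<Union>\<K> \<subseteq> ?q ` ?D" by blast
    have "{x \<in> ?D. ?q x \<in> \<Union>\<K>} = (\<Union>S\<in>\<K>. {x \<in> ?D. ?q x \<in> S})" by auto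
    then show "openin ?T {x \<in> ?D. ?q x \<in> \<Union>\<K>}" using K by (auto intro!: openin_Union)
  qed
  then show ?thesis by (simp add: orbit_topology_def)
qed

lemma topspace_orbit_topology: "topspace (orbit_topology k r s) = gauge_orbit k ` adhm_data k r s"
proof
  show "topspace (orbit_topology k r s) \<subseteq> gauge_orbit k ` adhm_data k r s"
    using openin_orbit_topology openin_topspace by blast
  have "{x \<in> adhm_data k r s. gauge_orbit k x \<in> gauge_orbit k ` adhm_data k r s} = adhm_data k r s"
    by auto
  then have "openin (orbit_topology k r s) (gauge_orbit k ` adhm_data k r s)"
    using openin_topspace[of "adhm_topology k r s"]
    by (simp add: openin_orbit_topology topspace_adhm_topology)
  then show "gauge_orbit k ` adhm_data k r s \<subseteq> topspace (orbit_topology k r s)"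
    by (rule openin_subset)
qed

lemma quotient_map_gauge_orbit:
  "quotient_map (adhm_topology k r s) (orbit_topology k r s) (gauge_orbit k)"
  by (auto simp: quotient_map_def openin_orbit_topology topspace_adhm_topology topspace_orbit_topology)

end

theory Submission
  imports Defs "Jordan_Normal_Form.Jordan_Normal_Form_Existence" "Jordan_Normal_Form.Spectral_Radius"
begin

text \<open>Any solution has commuting \<open>B\<^sub>a\<close>: substituting the first set of equations into
  \<open>\<parallel>[B\<^sub>1, B\<^sub>2]\<parallel>\<^sup>2 + \<parallel>[B\<^sub>1, B\<^sub>3]\<parallel>\<^sup>2 + \<parallel>[B\<^sub>1, B\<^sub>4]\<parallel>\<^sup>2\<close> turns it into the trace of the
  antisymmetrised product of the \<open>B\<^sub>a\<close>, which is zero. At a torus-fixed orbit each \<open>B\<^sub>a\<close> is unitarily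
  conjugate to \<open>u B\<^sub>a\<close> for every \<open>u\<close> of modulus 1, so its finite spectrum is invariant under rotation
  and \<open>B\<^sub>a\<close> is nilpotent.

  For commuting nilpotent \<open>B\<^sub>a\<close> the moment map equation bounds the norm. It says
  \<open>\<Sum>\<^sub>a \<parallel>B\<^sub>a\<^sup>\<dagger> w\<parallel>\<^sup>2 \<le> \<zeta> \<parallel>w\<parallel>\<^sup>2 + \<Sum>\<^sub>a \<parallel>B\<^sub>a w\<parallel>\<^sup>2\<close>. By induction on the number of steps in which the
  \<open>B\<^sub>a\<close> kill \<open>w\<close>, the right-hand side for \<open>B\<^sub>a w\<close> is at most \<open>c \<parallel>B\<^sub>a w\<parallel>\<^sup>2\<close>, and then Cauchy--Schwarz
  gives \<open>\<parallel>B\<^sub>a w\<parallel>\<^sup>2 \<le> c \<parallel>w\<parallel>\<^sup>2\<close>. The \<open>I\<close>'s are bounded by the moment map equation once the \<open>B\<^sub>a\<close> are.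
  So the fixed points lie in the image of a closed ball around 0 in the space of ADHM data. The norm
  is gauge invariant, so this image is closed as well as compact.\<close>

section \<open>Adjoint, trace and Frobenius norm\<close>

lemma mat_adjoint_carrier [simp, intro]:
  "A \<in> carrier_mat n m \<Longrightarrow> mat_adjoint A \<in> carrier_mat m n"
  by (auto simp: mat_adjoint_def)

lemma dim_mat_adjoint [simp]:
  "dim_row (mat_adjoint A) = dim_col A" "dim_col (mat_adjoint A) = dim_row A"
  by (auto simp: mat_adjoint_def)

lemma index_mat_adjoint [simp]:
  fixes A :: "complex mat"
  assumes "i < dim_col A" "j < dim_row A"
  shows "mat_adjoint A $$ (i, j) = cnj (A $$ (j, i))"
  using assms by (simp add: mat_adjoint_def mat_of_rows_def)

lemma mat_adjoint_adjoint [simp]: "mat_adjoint (mat_adjoint A) = (A :: complex mat)"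
  by (rule eq_matI) auto

lemma mat_adjoint_mult:
  fixes A B :: "complex mat"
  assumes "A \<in> carrier_mat n m" "B \<in> carrier_mat m l"
  shows "mat_adjoint (A * B) = mat_adjoint B * mat_adjoint A"
  using assms by (intro eq_matI) (auto simp: scalar_prod_def mult.commute)

lemma mat_adjoint_minus:
  fixes A B :: "complex mat"
  assumes "A \<in> carrier_mat n m" "B \<in> carrier_mat n m"
  shows "mat_adjoint (A - B) = mat_adjoint A - mat_adjoint B"
  using assms by (intro eq_matI) auto

lemma mat_adjoint_uminus: "mat_adjoint (- A) = - mat_adjoint (A :: complex mat)"
  by (rule eq_matI) auto

lemma mat_adjoint_one [simp]: "mat_adjoint (1\<^sub>m n) = (1\<^sub>m n :: complex mat)"
  by (rule eq_matI) auto

lemma mat_adjoint_zero [simp]: "mat_adjoint (0\<^sub>m n m) = (0\<^sub>m m n :: complex mat)"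
  by (rule eq_matI) auto

definition mat_trace :: "complex mat \<Rightarrow> complex" where
  "mat_trace A = (\<Sum>i<dim_row A. A $$ (i, i))"

lemma mat_trace_mult_commute:
  assumes "A \<in> carrier_mat n m" "B \<in> carrier_mat m n"
  shows "mat_trace (A * B) = mat_trace (B * A)"
proof -
  have "mat_trace (A * B) = (\<Sum>i<n. \<Sum>j<m. A $$ (i, j) * B $$ (j, i))"
    using assms by (simp add: mat_trace_def scalar_prod_def atLeast0LessThan)
  also have "\<dots> = (\<Sum>j<m. \<Sum>i<n. B $$ (j, i) * A $$ (i, j))"
    by (subst sum.swap) (simp add: mult.commute)
  also have "\<dots> = mat_trace (B * A)"
    using assms by (simp add: mat_trace_def scalar_prod_def atLeast0LessThan)
  finally show ?thesis .
qed

lemma mat_trace_add: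
  assumes "A \<in> carrier_mat n n" "B \<in> carrier_mat n n"
  shows "mat_trace (A + B) = mat_trace A + mat_trace B"
  using assms by (simp add: mat_trace_def sum.distrib)

lemma mat_trace_minus:
  assumes "A \<in> carrier_mat n n" "B \<in> carrier_mat n n"
  shows "mat_trace (A - B) = mat_trace A - mat_trace B"
  using assms by (simp add: mat_trace_def sum_subtractf)

lemma mat_trace_uminus: "A \<in> carrier_mat n n \<Longrightarrow> mat_trace (- A) = - mat_trace A"
  by (simp add: mat_trace_def sum_negf)

lemma mat_trace_smult: "A \<in> carrier_mat n n \<Longrightarrow> mat_trace (c \<cdot>\<^sub>m A) = c * mat_trace A"
  by (simp add: mat_trace_def sum_distrib_left)

definition frobenius_sq :: "complex mat \<Rightarrow> real" where
  "frobenius_sq A = (\<Sum>i<dim_row A. \<Sum>j<dim_col A. (cmod (A $$ (i, j)))\<^sup>2)"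

lemma frobenius_sq_nonneg: "0 \<le> frobenius_sq A"
  by (simp add: frobenius_sq_def sum_nonneg)

lemma frobenius_sq_zero [simp]: "frobenius_sq (0\<^sub>m n m) = 0"
  by (simp add: frobenius_sq_def)

lemma frobenius_sq_one [simp]: "frobenius_sq (1\<^sub>m n) = n"
proof -
  have "frobenius_sq (1\<^sub>m n) = (\<Sum>i<n. \<Sum>j<n. if i = j then 1 else 0)"
    unfolding frobenius_sq_def by (intro sum.cong) auto
  then show ?thesis by simp
qed

lemma frobenius_sq_eq_0:
  assumes "A \<in> carrier_mat n m" "frobenius_sq A = 0"
  shows "A = 0\<^sub>m n m"
  using assms by (intro eq_matI) (auto simp: frobenius_sq_def sum_nonneg_eq_0_iff sum_nonneg)

lemma frobenius_sq_trace: "of_real (frobenius_sq A) = mat_trace (A * mat_adjoint A)"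
  by (simp add: frobenius_sq_def mat_trace_def scalar_prod_def atLeast0LessThan
      complex_norm_square flip: of_real_power)

lemma frobenius_sq_adjoint [simp]: "frobenius_sq (mat_adjoint A) = frobenius_sq A"
  unfolding frobenius_sq_def by (subst sum.swap) simp

lemma frobenius_sq_eq_L2_set:
  "A \<in> carrier_mat n m \<Longrightarrow>
    frobenius_sq A = (L2_set (\<lambda>ij. cmod (A $$ ij)) ({..<n} \<times> {..<m}))\<^sup>2"
  by (simp add: frobenius_sq_def L2_set_def sum_nonneg sum.cartesian_product case_prod_unfold)

lemma trace_Cauchy_Schwarz:
  assumes "A \<in> carrier_mat n m" "B \<in> carrier_mat n m"
  shows "(cmod (mat_trace (A * mat_adjoint B)))\<^sup>2 \<le> frobenius_sq A * frobenius_sq B"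
proof -
  let ?S = "{..<n} \<times> {..<m}"
  have "mat_trace (A * mat_adjoint B) = (\<Sum>ij\<in>?S. A $$ ij * cnj (B $$ ij))"
    using assms
    by (simp add: mat_trace_def scalar_prod_def atLeast0LessThan sum.cartesian_product
        case_prod_unfold)
  also have "cmod \<dots> \<le> (\<Sum>ij\<in>?S. \<bar>cmod (A $$ ij)\<bar> * \<bar>cmod (B $$ ij)\<bar>)"
    by (rule order_trans[OF norm_sum]) (simp add: norm_mult)
  also have "\<dots> \<le> L2_set (\<lambda>ij. cmod (A $$ ij)) ?S * L2_set (\<lambda>ij. cmod (B $$ ij)) ?S"
    by (rule L2_set_mult_ineq)
  finally show ?thesis
    unfolding frobenius_sq_eq_L2_set[OF assms(1)] frobenius_sq_eq_L2_set[OF assms(2)]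
      power_mult_distrib[symmetric]
    by (rule power_mono) simp
qed

lemma frobenius_sq_mult_unitary:
  assumes g: "g \<in> unitary_group n" and A: "A \<in> carrier_mat n m"
  shows "frobenius_sq (g * A) = frobenius_sq A"
proof -
  have gc: "g \<in> carrier_mat n n" and gg: "mat_adjoint g * g = 1\<^sub>m n"
    using g by (auto simp: unitary_group_def)
  have "mat_trace (g * A * mat_adjoint (g * A)) = mat_trace (g * (A * mat_adjoint A * mat_adjoint g))"
    using gc A
    by (simp add: mat_adjoint_mult[OF gc A] mult_carrier_mat[of _ n m] mult_carrier_mat[of _ m n]
        assoc_mult_mat[of _ n n _ m _ n] assoc_mult_mat[of _ n m _ n _ n])
  also have "\<dots> = mat_trace (A * mat_adjoint A * mat_adjoint g * g)"
    using gc A by (intro mat_trace_mult_commute[of _ n n]) auto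
  also have "A * mat_adjoint A * mat_adjoint g * g = A * mat_adjoint A * (mat_adjoint g * g)"
    using gc A by (intro assoc_mult_mat[of _ n n _ n _ n]) auto
  also have "\<dots> = A * mat_adjoint A"
    using gg A by simp
  finally show ?thesis
    by (simp add: frobenius_sq_trace[symmetric])
qed

lemma frobenius_sq_conj_unitary:
  assumes g: "g \<in> unitary_group n" and A: "A \<in> carrier_mat n n"
  shows "frobenius_sq (g * A * mat_adjoint g) = frobenius_sq A"
proof -
  have gc: "g \<in> carrier_mat n n"
    using g by (auto simp: unitary_group_def)
  \<comment> \<open>Taking adjoints turns right multiplication by \<open>mat_adjoint g\<close> into
    left multiplication by \<open>g\<close>, so left invariance removes both factors.\<close>
  have "frobenius_sq (g * A * mat_adjoint g) = frobenius_sq (mat_adjoint (g * A * mat_adjoint g))"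
    by simp
  also have "mat_adjoint (g * A * mat_adjoint g) = g * mat_adjoint (g * A)"
    using gc A by (subst mat_adjoint_mult[of _ n n _ n]) auto
  also have "frobenius_sq \<dots> = frobenius_sq (mat_adjoint (g * A))"
    using gc A by (intro frobenius_sq_mult_unitary[OF g, of _ n]) auto
  also have "\<dots> = frobenius_sq A"
    using frobenius_sq_mult_unitary[OF g A] by simp
  finally show ?thesis .
qed

section \<open>Commutators\<close>

lemma commutator_carrier [simp, intro]:
  "A \<in> carrier_mat n n \<Longrightarrow> B \<in> carrier_mat n n \<Longrightarrow> commutator A B \<in> carrier_mat n n"
  unfolding commutator_def by (intro minus_carrier_mat mult_carrier_mat[of _ n n])

lemma mat_adjoint_commutator:
  assumes "A \<in> carrier_mat n n" "B \<in> carrier_mat n n"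
  shows "commutator (mat_adjoint A) (mat_adjoint B) = - mat_adjoint (commutator A B)"
  using assms by (auto simp: commutator_def mat_adjoint_minus[of _ n n] mat_adjoint_mult[of _ n n _ n])

text \<open>Cyclicity rotates every product so that \<open>A\<close> comes first. In this normal
  form equal traces cancel in the antisymmetrised sum by reassociation alone.\<close>

lemma mat_trace_commutator_mult:
  assumes "A \<in> carrier_mat n n" "B \<in> carrier_mat n n" "C \<in> carrier_mat n n" "D \<in> carrier_mat n n"
  shows "mat_trace (commutator A B * commutator C D) =
    mat_trace (A * B * (C * D)) - mat_trace (A * B * (D * C))
    - mat_trace (A * (C * D) * B) + mat_trace (A * (D * C) * B)"
proof -
  have "commutator A B * commutator C D =
      A * B * (C * D) - B * A * (C * D) - (A * B * (D * C) - B * A * (D * C))"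
    using assms
    by (simp add: commutator_def minus_mult_distrib_mat[of _ n n _ _ n] minus_carrier_mat
        mult_carrier_mat[of _ n n] mult_minus_distrib_mat[of _ n n _ n])
  then have "mat_trace (commutator A B * commutator C D) =
      mat_trace (A * B * (C * D)) - mat_trace (A * B * (D * C))
      - mat_trace (B * A * (C * D)) + mat_trace (B * A * (D * C))"
    using assms by (simp add: mat_trace_minus[of _ n] mult_carrier_mat[of _ n n] minus_carrier_mat)
  moreover have "mat_trace (B * A * X) = mat_trace (A * X * B)" if "X \<in> carrier_mat n n" for X
    using assms that mat_trace_mult_commute[of B n n "A * X"]
    by (simp add: assoc_mult_mat[of _ n n _ n _ n] mult_carrier_mat[of _ n n])
  ultimately show ?thesis using assms by (simp add: mult_carrier_mat[of _ n n])
qed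

text \<open>A cyclic rotation of four letters is an odd permutation, so the trace of the
  antisymmetrised product of four matrices vanishes.\<close>

lemma mat_trace_antisym4:
  assumes "A \<in> carrier_mat n n" "B \<in> carrier_mat n n" "C \<in> carrier_mat n n" "D \<in> carrier_mat n n"
  shows "mat_trace (commutator A B * commutator C D) - mat_trace (commutator A C * commutator B D)
    + mat_trace (commutator A D * commutator B C) = 0"
  using assms
  by (simp add: mat_trace_commutator_mult[of _ n] assoc_mult_mat[of _ n n _ n _ n]
      mult_carrier_mat[of _ n n])

lemma anti_self_dual_commute:
  assumes c: "B1 \<in> carrier_mat n n" "B2 \<in> carrier_mat n n" "B3 \<in> carrier_mat n n" "B4 \<in> carrier_mat n n"
    and e2: "commutator B1 B2 = - mat_adjoint (commutator B3 B4)"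
    and e3: "commutator B1 B3 = mat_adjoint (commutator B2 B4)"
    and e4: "commutator B1 B4 = - mat_adjoint (commutator B2 B3)"
  shows "commutator B1 B2 = 0\<^sub>m n n \<and> commutator B1 B3 = 0\<^sub>m n n \<and> commutator B1 B4 = 0\<^sub>m n n \<and>
    commutator B2 B3 = 0\<^sub>m n n \<and> commutator B2 B4 = 0\<^sub>m n n \<and> commutator B3 B4 = 0\<^sub>m n n"
proof -
  note cc = c[THEN commutator_carrier]
  \<comment> \<open>Each complementary commutator is expressed through the one containing
    \<open>B1\<close>; with these signs every term of \<open>mat_trace_antisym4\<close> becomes
    minus a squared norm.\<close>
  have d2: "commutator B3 B4 = - mat_adjoint (commutator B1 B2)"
    unfolding e2 mat_adjoint_uminus by simp
  have d3: "commutator B2 B4 = mat_adjoint (commutator B1 B3)"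
    unfolding e3 by simp
  have d4: "commutator B2 B3 = - mat_adjoint (commutator B1 B4)"
    unfolding e4 mat_adjoint_uminus by simp
  have neg: "mat_trace (- (X * mat_adjoint X)) = - of_real (frobenius_sq X)"
    if "X \<in> carrier_mat n n" for X
    using that by (simp add: frobenius_sq_trace mat_trace_uminus[of _ n] mult_carrier_mat[of _ n n])
  have "of_real (frobenius_sq (commutator B1 B2) + frobenius_sq (commutator B1 B3)
      + frobenius_sq (commutator B1 B4)) = (0 :: complex)"
    using mat_trace_antisym4[OF c] unfolding d2 d3 d4
    using c by (simp add: neg frobenius_sq_trace[symmetric] add_eq_0_iff)
  then have "frobenius_sq (commutator B1 B2) + frobenius_sq (commutator B1 B3)
      + frobenius_sq (commutator B1 B4) = 0"
    using of_real_eq_0_iff by blast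
  then have "frobenius_sq (commutator B1 B2) = 0" "frobenius_sq (commutator B1 B3) = 0"
    "frobenius_sq (commutator B1 B4) = 0"
    using frobenius_sq_nonneg[of "commutator B1 B2"] frobenius_sq_nonneg[of "commutator B1 B3"]
      frobenius_sq_nonneg[of "commutator B1 B4"] by linarith+
  then have "commutator B1 B2 = 0\<^sub>m n n" "commutator B1 B3 = 0\<^sub>m n n" "commutator B1 B4 = 0\<^sub>m n n"
    using c by (auto intro: frobenius_sq_eq_0)
  moreover have "- 0\<^sub>m n n = (0\<^sub>m n n :: complex mat)"
    by (rule eq_matI) auto
  ultimately show ?thesis using d2 d3 d4 by simp
qed

section \<open>Nilpotency\<close>

lemma smult_mat_mult_vec:
  fixes c :: complex
  assumes "A \<in> carrier_mat n m" "v \<in> carrier_vec m"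
  shows "(c \<cdot>\<^sub>m A) *\<^sub>v v = c \<cdot>\<^sub>v (A *\<^sub>v v)"
  using assms by (intro eq_vecI) auto

text \<open>Serves to kill a power of a Jordan matrix block by block. The total size
  \<open>N\<close> is left open, since similarity determines it later.\<close>

lemma diag_block_mat_zeros:
  assumes "\<forall>A\<in>set As. \<exists>n. A = 0\<^sub>m n n"
  shows "\<exists>N. diag_block_mat As = (0\<^sub>m N N :: complex mat)"
  using assms
proof (induction As)
  case (Cons A As)
  then obtain n N where "A = 0\<^sub>m n n" "diag_block_mat As = 0\<^sub>m N N"
    by auto
  then have "diag_block_mat (A # As) = 0\<^sub>m (n + N) (n + N)" by simp
  then show ?case by blast
qed auto

text \<open>All blocks of the Jordan form have eigenvalue 0 and size at most \<open>n\<close>, so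
  their \<open>n\<close>-th powers vanish.\<close>

lemma pow_eq_0_of_spectrum:
  fixes A :: "complex mat"
  assumes A: "A \<in> carrier_mat n n" and sp: "spectrum A \<subseteq> {0}"
  shows "A ^\<^sub>m n = 0\<^sub>m n n"
proof -
  obtain as where as: "char_poly A = (\<Prod>a\<leftarrow>as. [:- a, 1:])"
    using char_poly_factorized[OF A] by blast
  then obtain n_as where jnf: "jordan_nf A n_as"
    using jordan_nf_exists[OF A] by blast
  obtain P Q where PQ: "P \<in> carrier_mat n n" "Q \<in> carrier_mat n n"
    and cp: "char_poly A = (\<Prod>(na, a)\<leftarrow>n_as. [:- a, 1:] ^ na)"
    and pow: "\<And>k. A ^\<^sub>m k = P * jordan_matrix n_as ^\<^sub>m k * Q"
    using jordan_nf_powE[OF A jnf] by metis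
  have block: "jordan_block m a ^\<^sub>m n = 0\<^sub>m m m" if mem: "(m, a) \<in> set n_as" for m a
  proof -
    \<comment> \<open>A block of size 0 would say nothing about its label \<open>a\<close>; the
      Jordan form excludes it, so \<open>a\<close> is a root of the characteristic
      polynomial.\<close>
    have "m \<noteq> 0"
      using jnf mem by (force simp: jordan_nf_def)
    then have "poly (char_poly A) a = 0"
      unfolding cp poly_prod_list using mem
      by (force simp: prod_list_zero_iff o_def)
    then have "a = 0"
      using sp spectrum_root_char_poly[OF A] by auto
    moreover have "m \<le> n"
    proof -
      \<comment> \<open>The block size is at most the multiplicity of the root \<open>a\<close>,
        hence at most the degree \<open>n\<close>.\<close>
      have "char_poly A \<noteq> 0" "degree (char_poly A) = n"
        using degree_monic_char_poly[OF A] by auto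
      then show ?thesis
        using jordan_nf_block_size_order_bound[OF jnf mem] order_degree le_trans by metis
    qed
    ultimately show ?thesis
      by (auto simp: jordan_block_zero_pow intro!: eq_matI)
  qed
  then have "\<exists>N. jordan_matrix n_as ^\<^sub>m n = 0\<^sub>m N N"
    unfolding jordan_matrix_pow by (intro diag_block_mat_zeros) force
  then obtain N where N: "jordan_matrix n_as ^\<^sub>m n = 0\<^sub>m N N" by blast
  have "similar_mat A (jordan_matrix n_as)"
    using jnf by (simp add: jordan_nf_def)
  then have "jordan_matrix n_as \<in> carrier_mat n n"
    using A by (auto dest!: similar_matD)
  then have "N = n"
    using N by (metis carrier_matD(1) index_zero_mat(2) pow_carrier_mat)
  then show ?thesis
    using pow[of n] N PQ by simp
qed

lemma pow_eq_0_of_rotation_invariant: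
  fixes A :: "complex mat"
  assumes A: "A \<in> carrier_mat n n"
    and rot: "\<And>u. cmod u = 1 \<Longrightarrow> \<exists>g\<in>unitary_group n. u \<cdot>\<^sub>m A = g * A * mat_adjoint g"
  shows "A ^\<^sub>m n = 0\<^sub>m n n"
proof (rule pow_eq_0_of_spectrum[OF A], rule subsetI, rule ccontr)
  fix e assume e: "e \<in> spectrum A" and "e \<notin> {0}"
  then have e0: "e \<noteq> 0" by simp
  have "u * e \<in> spectrum A" if u: "cmod u = 1" for u
  proof -
    obtain g where g: "g \<in> unitary_group n" and ug: "u \<cdot>\<^sub>m A = g * A * mat_adjoint g"
      using rot[OF u] by blast
    \<comment> \<open>Similarity preserves the spectrum, while scaling by \<open>u\<close>
      multiplies eigenvalues by \<open>u\<close>.\<close>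
    have "similar_mat (u \<cdot>\<^sub>m A) A"
      using g A ug by (intro similar_matI[of _ _ g "mat_adjoint g" n]) (auto simp: unitary_group_def)
    then have cp: "char_poly (u \<cdot>\<^sub>m A) = char_poly A"
      by (rule char_poly_similar)
    obtain v where v: "v \<in> carrier_vec n" "v \<noteq> 0\<^sub>v n" "A *\<^sub>v v = e \<cdot>\<^sub>v v"
      using e A by (auto simp: spectrum_def eigenvalue_def eigenvector_def)
    have "(u \<cdot>\<^sub>m A) *\<^sub>v v = (u * e) \<cdot>\<^sub>v v"
      using v A by (simp add: smult_mat_mult_vec smult_smult_assoc)
    then have "u * e \<in> spectrum (u \<cdot>\<^sub>m A)"
      using v A by (auto simp: spectrum_def eigenvalue_def eigenvector_def)
    then show ?thesis
      using cp spectrum_root_char_poly[OF A] spectrum_root_char_poly[of "u \<cdot>\<^sub>m A" n] A by simp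
  qed
  then have "(\<lambda>u. u * e) ` sphere 0 1 \<subseteq> spectrum A" by auto
  then have "finite ((\<lambda>u. u * e) ` sphere 0 1)"
    using card_finite_spectrum(1)[OF A] by (rule finite_subset)
  moreover have "inj_on (\<lambda>u. u * e) (sphere 0 1)"
    using e0 by (auto intro: inj_onI)
  ultimately have "finite (sphere (0::complex) 1)"
    using finite_imageD by blast
  \<comment> \<open>The circle is infinite: a finite connected set has at most one point, but the
    circle contains 1 and -1.\<close>
  moreover have "connected (sphere (0::complex) 1)"
    by (rule connected_sphere) simp
  moreover have "1 \<in> sphere (0::complex) 1" "-1 \<in> sphere (0::complex) 1" by auto
  ultimately show False
    unfolding connected_finite_iff_sing[OF \<open>connected (sphere 0 1)\<close>]
    by (metis empty_iff one_neq_neg_one singletonD)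
qed

section \<open>The moment map equation\<close>

lemma mat_trace_mat_sum_mult:
  assumes "P \<in> carrier_mat n n" "\<And>s. s \<in> S \<Longrightarrow> f s \<in> carrier_mat n n"
  shows "mat_trace (mat_sum n n f S * P) = (\<Sum>s\<in>S. mat_trace (f s * P))"
proof -
  have "mat_trace (mat_sum n n f S * P) = (\<Sum>i<n. \<Sum>l<n. \<Sum>s\<in>S. f s $$ (i, l) * P $$ (l, i))"
    using assms(1)
    by (simp add: mat_trace_def mat_sum_def scalar_prod_def atLeast0LessThan sum_distrib_right)
  also have "\<dots> = (\<Sum>s\<in>S. \<Sum>i<n. \<Sum>l<n. f s $$ (i, l) * P $$ (l, i))"
    by (subst sum.swap[of _ S]) (intro sum.cong refl sum.swap)
  also have "\<dots> = (\<Sum>s\<in>S. mat_trace (f s * P))"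
  proof (rule sum.cong[OF refl])
    fix s assume "s \<in> S"
    then have "f s \<in> carrier_mat n n" by (rule assms(2))
    then show "(\<Sum>i<n. \<Sum>l<n. f s $$ (i, l) * P $$ (l, i)) = mat_trace (f s * P)"
      using assms(1) by (simp add: mat_trace_def scalar_prod_def atLeast0LessThan)
  qed
  finally show ?thesis .
qed

text \<open>By cyclicity the left side is the trace of \<open>X * mat_adjoint X\<close> for
  \<open>X = mat_adjoint C * w\<close>.\<close>

lemma mat_trace_gram:
  assumes C: "C \<in> carrier_mat n l" and w: "w \<in> carrier_mat n m"
  shows "mat_trace (C * mat_adjoint C * (w * mat_adjoint w)) =
    of_real (frobenius_sq (mat_adjoint C * w))"
proof -
  have "mat_trace (C * mat_adjoint C * (w * mat_adjoint w)) =
      mat_trace (C * (mat_adjoint C * w * mat_adjoint w))"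
    using C w by (simp add: assoc_mult_mat[of _ n l _ n _ n] assoc_mult_mat[of _ l n _ m _ n]
        mult_carrier_mat[of _ n m])
  also have "\<dots> = mat_trace (mat_adjoint C * w * mat_adjoint w * C)"
    using C w by (intro mat_trace_mult_commute[of _ n l] mult_carrier_mat[of _ l m]
        mult_carrier_mat[of _ l n] mat_adjoint_carrier)
  also have "mat_adjoint C * w * mat_adjoint w * C = mat_adjoint C * w * mat_adjoint (mat_adjoint C * w)"
    using C w by (simp add: mat_adjoint_mult[of _ l n _ m] assoc_mult_mat[of _ l m _ n _ l]
        mult_carrier_mat[of _ l n])
  finally show ?thesis by (simp add: frobenius_sq_trace)
qed

lemma mat_trace_commutator_gram:
  assumes B: "B \<in> carrier_mat n n" and w: "w \<in> carrier_mat n m"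
  shows "mat_trace (commutator B (mat_adjoint B) * (w * mat_adjoint w)) =
    of_real (frobenius_sq (mat_adjoint B * w) - frobenius_sq (B * w))"
proof -
  have P: "w * mat_adjoint w \<in> carrier_mat n n"
    using w by (intro mult_carrier_mat[of _ n m]) auto
  then have "commutator B (mat_adjoint B) * (w * mat_adjoint w) =
      B * mat_adjoint B * (w * mat_adjoint w) - mat_adjoint B * B * (w * mat_adjoint w)"
    using B by (simp add: commutator_def minus_mult_distrib_mat[of _ n n _ _ n]
        mult_carrier_mat[of _ n n])
  moreover have "mat_trace (B * mat_adjoint B * (w * mat_adjoint w)) =
      of_real (frobenius_sq (mat_adjoint B * w))"
    by (rule mat_trace_gram[OF B w])
  moreover have "mat_trace (mat_adjoint B * B * (w * mat_adjoint w)) = of_real (frobenius_sq (B * w))"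
    using mat_trace_gram[OF mat_adjoint_carrier[OF B] w] by simp
  ultimately show ?thesis
    using B P by (simp add: mat_trace_minus[of _ n] mult_carrier_mat[of _ n n])
qed

text \<open>Multiplying the moment map equation by \<open>w * mat_adjoint w\<close> and taking the
  trace turns each term into a squared norm. Since \<open>w\<close> is a matrix rather than a
  vector, \<open>w = 1\<^sub>m k\<close> is allowed and yields the norms of the \<open>B a\<close>,
  \<open>I1\<close> and \<open>I2\<close> themselves.\<close>

lemma moment_map_frobenius:
  assumes sol: "(B, I1, I2) \<in> adhm_solutions A1 A2 k r s \<zeta>" and w: "w \<in> carrier_mat k m"
  shows "(\<Sum>a\<in>{1..4}. frobenius_sq (mat_adjoint (B a) * w))
      + frobenius_sq (mat_adjoint I1 * w) + frobenius_sq (mat_adjoint I2 * w)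
    = \<zeta> * frobenius_sq w + (\<Sum>a\<in>{1..4}. frobenius_sq (B a * w))"
proof -
  let ?P = "w * mat_adjoint w"
  let ?C = "mat_sum k k (\<lambda>a. commutator (B a) (mat_adjoint (B a))) {1..4}"
  have B: "B a \<in> carrier_mat k k" if "a \<in> {1..4}" for a
    using sol that by (auto simp: adhm_solutions_def adhm_data_def)
  have I: "I1 \<in> carrier_mat k r" "I2 \<in> carrier_mat k s"
    using sol by (auto simp: adhm_solutions_def adhm_data_def)
  have eq: "?C + I1 * mat_adjoint I1 + I2 * mat_adjoint I2 = complex_of_real \<zeta> \<cdot>\<^sub>m 1\<^sub>m k"
    using sol by (simp add: adhm_solutions_def)
  have P: "?P \<in> carrier_mat k k"
    using w by (intro mult_carrier_mat[of _ k m]) auto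
  have C: "?C \<in> carrier_mat k k"
    by (simp add: mat_sum_def)
  have II: "I1 * mat_adjoint I1 \<in> carrier_mat k k" "I2 * mat_adjoint I2 \<in> carrier_mat k k"
    using I by (auto intro: mult_carrier_mat)
  have "mat_trace ((?C + I1 * mat_adjoint I1 + I2 * mat_adjoint I2) * ?P) =
      mat_trace (?C * ?P) + mat_trace (I1 * mat_adjoint I1 * ?P) + mat_trace (I2 * mat_adjoint I2 * ?P)"
    using C II P by (simp only: add_mult_distrib_mat[of _ k k _ _ k] add_carrier_mat
        mat_trace_add[of _ k] mult_carrier_mat[of _ k k])
  also have "mat_trace (?C * ?P) = (\<Sum>a\<in>{1..4}. mat_trace (commutator (B a) (mat_adjoint (B a)) * ?P))"
    using B by (intro mat_trace_mat_sum_mult[OF P] commutator_carrier mat_adjoint_carrier)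
  also have "\<dots> = (\<Sum>a\<in>{1..4}. of_real (frobenius_sq (mat_adjoint (B a) * w) - frobenius_sq (B a * w)))"
    by (rule sum.cong[OF refl mat_trace_commutator_gram[OF B w]])
  also have "mat_trace (I1 * mat_adjoint I1 * ?P) = of_real (frobenius_sq (mat_adjoint I1 * w))"
    by (rule mat_trace_gram[OF I(1) w])
  also have "mat_trace (I2 * mat_adjoint I2 * ?P) = of_real (frobenius_sq (mat_adjoint I2 * w))"
    by (rule mat_trace_gram[OF I(2) w])
  also have "mat_trace ((?C + I1 * mat_adjoint I1 + I2 * mat_adjoint I2) * ?P) =
      of_real (\<zeta> * frobenius_sq w)"
    unfolding eq using P
    by (simp add: mult_smult_assoc_mat[of _ k k _ k] mat_trace_smult[of _ k] frobenius_sq_trace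
        left_mult_one_mat[OF P])
  finally have "complex_of_real (\<zeta> * frobenius_sq w) =
      of_real ((\<Sum>a\<in>{1..4}. frobenius_sq (mat_adjoint (B a) * w) - frobenius_sq (B a * w))
        + frobenius_sq (mat_adjoint I1 * w) + frobenius_sq (mat_adjoint I2 * w))"
    by simp
  then have "\<zeta> * frobenius_sq w =
      (\<Sum>a\<in>{1..4}. frobenius_sq (mat_adjoint (B a) * w) - frobenius_sq (B a * w))
        + frobenius_sq (mat_adjoint I1 * w) + frobenius_sq (mat_adjoint I2 * w)"
    by (simp only: of_real_eq_iff)
  then show ?thesis by (simp only: sum_subtractf)
qed

section \<open>Bounding commuting nilpotent matrices\<close>

lemma pow_mat_commute:
  fixes A B :: "complex mat"
  assumes "A \<in> carrier_mat n n" "B \<in> carrier_mat n n" "A * B = B * A"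
  shows "A ^\<^sub>m j * B = B * A ^\<^sub>m j"
proof (induction j)
  case (Suc j)
  have pj: "A ^\<^sub>m j \<in> carrier_mat n n"
    using assms(1) by simp
  have "A ^\<^sub>m Suc j * B = A ^\<^sub>m j * (A * B)"
    using assms(1,2) pj by (simp add: assoc_mult_mat[of _ n n _ n _ n])
  also have "\<dots> = A ^\<^sub>m j * B * A"
    unfolding assms(3) using assms(1,2) pj by (simp add: assoc_mult_mat[of _ n n _ n _ n])
  also have "\<dots> = B * A ^\<^sub>m Suc j"
    unfolding Suc.IH using assms(1,2) pj by (simp add: assoc_mult_mat[of _ n n _ n _ n])
  finally show ?case .
qed (use assms in simp)

text \<open>Cauchy--Schwarz applied to \<open>\<parallel>B w\<parallel>\<^sup>2 = \<langle>w, B\<^sup>\<dagger> B w\<rangle>\<close>.\<close>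

lemma frobenius_sq_mult_le:
  assumes B: "B \<in> carrier_mat n n" and w: "w \<in> carrier_mat n m"
    and c: "0 \<le> c" and le: "frobenius_sq (mat_adjoint B * (B * w)) \<le> c * frobenius_sq (B * w)"
  shows "frobenius_sq (B * w) \<le> c * frobenius_sq w"
proof (cases "frobenius_sq (B * w) = 0")
  case True
  then show ?thesis using c frobenius_sq_nonneg by simp
next
  case False
  then have pos: "frobenius_sq (B * w) > 0"
    using frobenius_sq_nonneg[of "B * w"] by simp
  let ?u = "mat_adjoint B * (B * w)"
  have Bw: "B * w \<in> carrier_mat n m"
    using B w by (rule mult_carrier_mat)
  have u: "?u \<in> carrier_mat n m"
    by (rule mult_carrier_mat[OF mat_adjoint_carrier[OF B] Bw])
  have "mat_trace (?u * mat_adjoint w) = mat_trace (mat_adjoint B * (B * w * mat_adjoint w))"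
    using B Bw w by (simp add: assoc_mult_mat[of _ n n _ m _ n])
  also have "\<dots> = mat_trace (B * w * mat_adjoint w * mat_adjoint B)"
    by (rule mat_trace_mult_commute[OF mat_adjoint_carrier[OF B]
          mult_carrier_mat[OF Bw mat_adjoint_carrier[OF w]]])
  also have "B * w * mat_adjoint w * mat_adjoint B = B * w * mat_adjoint (B * w)"
    using B Bw w by (simp add: mat_adjoint_mult[of _ n n _ m] assoc_mult_mat[of _ n m _ n _ n])
  finally have "mat_trace (?u * mat_adjoint w) = of_real (frobenius_sq (B * w))"
    by (simp add: frobenius_sq_trace)
  then have "(frobenius_sq (B * w))\<^sup>2 \<le> frobenius_sq ?u * frobenius_sq w"
    using trace_Cauchy_Schwarz[OF u w] by simp
  also have "\<dots> \<le> c * frobenius_sq (B * w) * frobenius_sq w"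
    by (rule mult_right_mono[OF le frobenius_sq_nonneg])
  \<comment> \<open>One factor \<open>frobenius_sq (B * w)\<close> cancels, which is why it was made
    positive.\<close>
  finally have "frobenius_sq (B * w) * frobenius_sq (B * w) \<le> frobenius_sq (B * w) * (c * frobenius_sq w)"
    by (simp add: power2_eq_square algebra_simps)
  then show ?thesis
    using pos by simp
qed

text \<open>Here \<open>s\<close> counts the matrices and \<open>N\<close> is the sum of the
  exponents that kill \<open>w\<close>. Applying one matrix lowers that sum by one, which bounds
  each of the \<open>s\<close> summands by \<open>\<zeta> + nilpotent_bound s \<zeta> N\<close>
  times the squared norm of \<open>w\<close>.\<close>

primrec nilpotent_bound :: "nat \<Rightarrow> real \<Rightarrow> nat \<Rightarrow> real" where
  "nilpotent_bound s \<zeta> 0 = 0"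
| "nilpotent_bound s \<zeta> (Suc N) = real s * (\<zeta> + nilpotent_bound s \<zeta> N)"

lemma nilpotent_bound_nonneg: "0 \<le> \<zeta> \<Longrightarrow> 0 \<le> nilpotent_bound s \<zeta> N"
  by (induction N) auto

text \<open>Each matrix has its own exponent \<open>n a\<close>, and the induction runs over their
  sum. Passing from \<open>w\<close> to \<open>B a * w\<close> lowers the exponent of
  \<open>a\<close> by one, and commutativity keeps the other exponents valid.\<close>

lemma commuting_nilpotent_frobenius_bound:
  assumes fin: "finite S" and B: "\<And>a. a \<in> S \<Longrightarrow> B a \<in> carrier_mat k k"
    and comm: "\<And>a b. a \<in> S \<Longrightarrow> b \<in> S \<Longrightarrow> B a * B b = B b * B a"
    and zeta: "0 \<le> \<zeta>"
    and moment: "\<And>w. w \<in> carrier_mat k m \<Longrightarrow>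
      (\<Sum>a\<in>S. frobenius_sq (mat_adjoint (B a) * w)) \<le> \<zeta> * frobenius_sq w + (\<Sum>a\<in>S. frobenius_sq (B a * w))"
    and w: "w \<in> carrier_mat k m" and nil: "\<And>a. a \<in> S \<Longrightarrow> B a ^\<^sub>m n a * w = 0\<^sub>m k m"
  shows "(\<Sum>a\<in>S. frobenius_sq (B a * w)) \<le> nilpotent_bound (card S) \<zeta> (sum n S) * frobenius_sq w"
  using w nil
proof (induction "sum n S" arbitrary: n w)
  case 0
  have "frobenius_sq (B a * w) = 0" if a: "a \<in> S" for a
  proof -
    have "n a = 0" using "0.hyps" fin a by simp
    then have "w = 0\<^sub>m k m" using "0.prems"(1) "0.prems"(2)[OF a] B[OF a] by simp
    then show ?thesis using B[OF a] by simp
  qed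
  then show ?case using "0.hyps" by simp
next
  case (Suc N)
  let ?c = "\<zeta> + nilpotent_bound (card S) \<zeta> N"
  have "frobenius_sq (B a * w) \<le> ?c * frobenius_sq w" if a: "a \<in> S" for a
  proof (cases "n a")
    case 0
    \<comment> \<open>Exponent 0 cannot be lowered, but it says that \<open>w\<close> is
      zero.\<close>
    then have "w = 0\<^sub>m k m" using Suc.prems(1) Suc.prems(2)[OF a] B[OF a] by simp
    then show ?thesis using B[OF a] by simp
  next
    case (Suc j)
    define v where "v = B a * w"
    have v: "v \<in> carrier_mat k m"
      unfolding v_def using B[OF a] Suc.prems(1) by (rule mult_carrier_mat)
    let ?n = "n(a := j)"
    have "sum n S = Suc (sum ?n S)"
      using fin a Suc by (simp add: sum.remove[of S a])
    then have N: "N = sum ?n S"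
      using Suc.hyps(2) by simp
    have nil': "B b ^\<^sub>m ?n b * v = 0\<^sub>m k m" if b: "b \<in> S" for b
    proof (cases "b = a")
      case True
      have "B a ^\<^sub>m j * v = B a ^\<^sub>m Suc j * w"
        unfolding v_def using B[OF a] Suc.prems(1)
        by (simp add: assoc_mult_mat[of _ k k _ k _ m])
      then show ?thesis using True Suc Suc.prems(2)[OF a] by simp
    next
      case False
      have "B b ^\<^sub>m n b * v = B b ^\<^sub>m n b * B a * w"
        unfolding v_def using B[OF a] B[OF b] Suc.prems(1)
        by (simp add: assoc_mult_mat[of _ k k _ k _ m])
      also have "\<dots> = B a * B b ^\<^sub>m n b * w"
        using pow_mat_commute[OF B[OF b] B[OF a] comm[OF b a]] by simp
      also have "\<dots> = B a * (B b ^\<^sub>m n b * w)"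
        using B[OF a] B[OF b] Suc.prems(1) by (simp add: assoc_mult_mat[of _ k k _ k _ m])
      also have "\<dots> = 0\<^sub>m k m"
        using Suc.prems(2)[OF b] B[OF a] by simp
      finally show ?thesis using False by simp
    qed
    \<comment> \<open>One term is at most the whole sum; the moment inequality and the induction
      hypothesis at \<open>v\<close> then give the premise of
      \<open>frobenius_sq_mult_le\<close>.\<close>
    have "frobenius_sq (mat_adjoint (B a) * v) \<le> (\<Sum>a\<in>S. frobenius_sq (mat_adjoint (B a) * v))"
      using fin a by (intro member_le_sum) (auto simp: frobenius_sq_nonneg)
    also have "\<dots> \<le> \<zeta> * frobenius_sq v + (\<Sum>a\<in>S. frobenius_sq (B a * v))"
      by (rule moment[OF v])
    also have "\<dots> \<le> ?c * frobenius_sq v"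
      using Suc.hyps(1)[OF N v nil'] by (simp add: N[symmetric] distrib_right del: fun_upd_apply)
    finally show ?thesis
      unfolding v_def using zeta nilpotent_bound_nonneg[OF zeta]
      by (intro frobenius_sq_mult_le[OF B[OF a] Suc.prems(1)]) auto
  qed
  then have "(\<Sum>a\<in>S. frobenius_sq (B a * w)) \<le> (\<Sum>a\<in>S. ?c * frobenius_sq w)"
    by (rule sum_mono)
  then show ?case
    by (simp add: Suc.hyps(2)[symmetric] algebra_simps)
qed

section \<open>Torus-fixed solutions are bounded\<close>

lemma adhm_data_carrier:
  assumes "(B, I1, I2) \<in> adhm_data k r s"
  shows "\<And>a. a \<in> {1..4} \<Longrightarrow> B a \<in> carrier_mat k k" "I1 \<in> carrier_mat k r" "I2 \<in> carrier_mat k s"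
  using assms by (auto simp: adhm_data_def)

lemma adhm_solutions_data: "adhm_solutions A1 A2 k r s \<zeta> \<subseteq> adhm_data k r s"
  by (auto simp: adhm_solutions_def)

text \<open>Only the two orders of the complementary pair have a nonzero sign; antisymmetry makes
  their contributions equal and 1/2 removes the doubling. The pairs containing 1 give all three
  splittings of the indices into two pairs.\<close>

lemma levi_civita_mat_sum:
  fixes f :: "nat \<Rightarrow> nat \<Rightarrow> complex mat"
  assumes f: "\<And>c d. c \<in> {1..4} \<Longrightarrow> d \<in> {1..4} \<Longrightarrow> f c d \<in> carrier_mat k k"
    and anti: "\<And>c d. c \<in> {1..4} \<Longrightarrow> d \<in> {1..4} \<Longrightarrow> f d c = - f c d"
  defines "\<sigma> \<equiv> \<lambda>a b. (1/2) \<cdot>\<^sub>m mat_sum k k (\<lambda>(c, d). of_int (levi_civita a b c d) \<cdot>\<^sub>m f c d) ({1..4} \<times> {1..4})"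
  shows "\<sigma> 1 2 = f 3 4" "\<sigma> 1 3 = - f 2 4" "\<sigma> 1 4 = f 2 3"
proof -
  have S: "{1..4} = {1, 2, 3, 4 :: nat}" by auto
  have dim [simp]: "dim_row (f c d) = k" "dim_col (f c d) = k" if "c \<in> {1,2,3,4}" "d \<in> {1,2,3,4}" for c d
    using f[of c d] that unfolding S by auto
  have anti': "f 4 3 $$ (i, j) = - f 3 4 $$ (i, j)" "f 4 2 $$ (i, j) = - f 2 4 $$ (i, j)"
    "f 3 2 $$ (i, j) = - f 2 3 $$ (i, j)" if "i < k" "j < k" for i j
    using anti[of 3 4] anti[of 2 4] anti[of 2 3] that by auto
  have *: "\<sigma> a b $$ (i, j) = (1/2) * (\<Sum>c\<in>{1,2,3,4}. \<Sum>d\<in>{1,2,3,4}.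
      of_int (levi_civita a b c d) * f c d $$ (i, j))" if "i < k" "j < k" for a b i j
    using that unfolding \<sigma>_def S
    by (simp add: mat_sum_def sum.cartesian_product[symmetric] case_prod_unfold del: sum.insert)
  have dims: "\<sigma> a b \<in> carrier_mat k k" for a b
    by (simp add: \<sigma>_def mat_sum_def)
  show "\<sigma> 1 2 = f 3 4" "\<sigma> 1 3 = - f 2 4" "\<sigma> 1 4 = f 2 3"
    using dims[of 1 2] dims[of 1 3] dims[of 1 4]
    by (auto intro!: eq_matI simp: * anti' levi_civita_def)
qed

lemma mat_eq_of_diff_zero:
  fixes A B :: "complex mat"
  assumes "A \<in> carrier_mat n m" "B \<in> carrier_mat n m" "A - B = 0\<^sub>m n m"
  shows "A = B"
proof (rule eq_matI)
  fix i j assume ij: "i < dim_row B" "j < dim_col B"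
  have "(A - B) $$ (i, j) = 0"
    unfolding assms(3) using assms(2) ij by simp
  then show "A $$ (i, j) = B $$ (i, j)"
    using ij by simp
qed (use assms(1,2) in auto)

lemma adhm_solutions_commute:
  assumes sol: "(B, I1, I2) \<in> adhm_solutions A1 A2 k r s \<zeta>"
    and a: "a \<in> {1..4}" and b: "b \<in> {1..4}"
  shows "B a * B b = B b * B a"
proof -
  have B: "B a \<in> carrier_mat k k" if "a \<in> {1..4}" for a
    using sol adhm_solutions_data adhm_data_carrier(1) that by blast
  define f where "f = (\<lambda>c d. commutator (mat_adjoint (B c)) (mat_adjoint (B d)))"
  let ?\<sigma> = "\<lambda>a b. (1/2) \<cdot>\<^sub>m mat_sum k k (\<lambda>(c, d). of_int (levi_civita a b c d) \<cdot>\<^sub>m f c d) ({1..4} \<times> {1..4})"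
  have f: "f c d \<in> carrier_mat k k" "f d c = - f c d" if "c \<in> {1..4}" "d \<in> {1..4}" for c d
    using B[OF that(1)] B[OF that(2)] by (auto simp: f_def commutator_def)
  have \<sigma>: "?\<sigma> 1 2 = f 3 4" "?\<sigma> 1 3 = - f 2 4" "?\<sigma> 1 4 = f 2 3"
    by (rule levi_civita_mat_sum; rule f; assumption)+
  have c: "commutator (B a) (B b) = ?\<sigma> a b" if "a \<in> {1..4}" "b \<in> {1..4}" "a < b" for a b
  proof -
    have "commutator (B a) (B b) - ?\<sigma> a b = 0\<^sub>m k k"
      using sol that by (simp add: adhm_solutions_def f_def)
    moreover have "commutator (B a) (B b) \<in> carrier_mat k k" "?\<sigma> a b \<in> carrier_mat k k"
      using B that by (auto simp: mat_sum_def)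
    ultimately show ?thesis
      using mat_eq_of_diff_zero by blast
  qed
  \<comment> \<open>A commutator of adjoints is minus the adjoint of the commutator, which gives the
    shape required by \<open>anti_self_dual_commute\<close>.\<close>
  have "commutator (B 1) (B 2) = - mat_adjoint (commutator (B 3) (B 4))"
    "commutator (B 1) (B 3) = mat_adjoint (commutator (B 2) (B 4))"
    "commutator (B 1) (B 4) = - mat_adjoint (commutator (B 2) (B 3))"
    using trans[OF c \<sigma>(1)] trans[OF c \<sigma>(2)] trans[OF c \<sigma>(3)] B
    by (simp_all add: f_def mat_adjoint_commutator[of _ k])
  from anti_self_dual_commute[OF B B B B this]
  have "\<forall>a\<in>{1,2,3,4}. \<forall>b\<in>{1,2,3,4}. a < b \<longrightarrow> commutator (B a) (B b) = 0\<^sub>m k k"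
    by simp
  moreover have "{1,2,3,4} = {1..4::nat}" by auto
  ultimately have "\<forall>a\<in>{1..4}. \<forall>b\<in>{1..4}. a < b \<longrightarrow> commutator (B a) (B b) = 0\<^sub>m k k"
    by (simp only:)
  then have comm: "commutator (B a) (B b) = 0\<^sub>m k k" if "a \<in> {1..4}" "b \<in> {1..4}" "a < b" for a b
    using that by blast
  have lt: "B a * B b = B b * B a" if "a \<in> {1..4}" "b \<in> {1..4}" "a < b" for a b
    by (rule mat_eq_of_diff_zero[OF mult_carrier_mat[OF B B] mult_carrier_mat[OF B B]])
      (use that comm[OF that] in \<open>simp_all add: commutator_def\<close>)
  show ?thesis
    using lt[OF a b] lt[OF b a] by (cases a b rule: linorder_cases) auto
qed

section \<open>Nilpotency at torus-fixed orbits\<close>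

lemma one_mem_unitary_group: "1\<^sub>m n \<in> unitary_group n"
  by (simp add: unitary_group_def)

lemma mem_gauge_orbit:
  assumes "x \<in> adhm_data k r s"
  shows "x \<in> gauge_orbit k x"
proof -
  obtain B I1 I2 where x: "x = (B, I1, I2)" by (rule prod_cases3)
  note c = adhm_data_carrier[OF assms[unfolded x]]
  \<comment> \<open>Outside \<open>{1..4}\<close> both functions are \<open>undefined\<close>, since
    \<open>B\<close> is extensional.\<close>
  have "(\<lambda>a\<in>{1..4}. 1\<^sub>m k * B a * mat_adjoint (1\<^sub>m k)) = B"
  proof
    fix a show "(\<lambda>a\<in>{1..4}. 1\<^sub>m k * B a * mat_adjoint (1\<^sub>m k)) a = B a"
      using c(1)[of a] assms by (cases "a \<in> {1..4}") (auto simp: x adhm_data_def)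
  qed
  then have "gauge_act (1\<^sub>m k) x = x"
    using c by (simp add: x gauge_act_def)
  then show ?thesis
    using one_mem_unitary_group by (force simp: gauge_orbit_def)
qed

text \<open>Each of the weights \<open>inverse t1\<close>, \<open>inverse t2\<close> and
  \<open>t1\<^sup>2 * t2\<close> takes every value of modulus 1 already when a suitable one of the
  two parameters is 1.\<close>

lemma torus_weight_surj:
  assumes "cmod u = 1"
  obtains t1 t2 where "cmod t1 = 1" "cmod t2 = 1" "torus_weight A1 A2 t1 t2 a = u"
proof -
  have "cmod (inverse u) = 1"
    using assms by (simp add: norm_inverse)
  then consider "a \<in> A1 \<inter> A2" | "a \<notin> A1 \<inter> A2" "a = compl_idx A2" | "a \<notin> A1 \<inter> A2" "a \<noteq> compl_idx A2"
    by blast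
  then show thesis
  proof cases
    case 1
    then show thesis using that[of "inverse u" 1] assms by (simp add: torus_weight_def norm_inverse)
  next
    case 2
    then have "torus_weight A1 A2 1 (inverse u) a = u"
      by (simp only: torus_weight_def if_False if_True inverse_inverse_eq simp_thms)
    then show thesis using that[of 1 "inverse u"] assms by (simp add: norm_inverse)
  next
    case 3
    then show thesis using that[of 1 u] assms by (auto simp add: torus_weight_def)
  qed
qed

lemma torus_fixed_nilpotent:
  assumes x: "(B, I1, I2) \<in> adhm_data k r s"
    and fixed: "gauge_orbit k (B, I1, I2) \<in> torus_fixed_moduli A1 A2 k r s \<zeta>"
    and a: "a \<in> {1..4}"
  shows "B a ^\<^sub>m k = 0\<^sub>m k k"
proof (rule pow_eq_0_of_rotation_invariant[OF adhm_data_carrier(1)[OF x a]])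
  fix u :: complex assume "cmod u = 1"
  then obtain t1 t2 where t: "cmod t1 = 1" "cmod t2 = 1" "torus_weight A1 A2 t1 t2 a = u"
    by (rule torus_weight_surj)
  \<comment> \<open>The phase on \<open>B a\<close> comes from \<open>t1\<close> and
    \<open>t2\<close> alone, so the framing rotations are taken to be the identity.\<close>
  let ?t = "(t1, t2, 1\<^sub>m r, 1\<^sub>m s)"
  have "?t \<in> torus r s"
    using t one_mem_unitary_group by (simp add: torus_def diagonal_mat_def)
  then have "torus_act A1 A2 ?t ` gauge_orbit k (B, I1, I2) = gauge_orbit k (B, I1, I2)"
    using fixed unfolding torus_fixed_moduli_def by blast
  \<comment> \<open>Invariance of the orbit as a set puts the image of the representative back in
    it; the gauge element reached is the required conjugation.\<close>
  then have "torus_act A1 A2 ?t (B, I1, I2) \<in> gauge_orbit k (B, I1, I2)"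
    using mem_gauge_orbit[OF x] by blast
  then obtain g where g: "g \<in> unitary_group k"
    and eq: "torus_act A1 A2 ?t (B, I1, I2) = gauge_act g (B, I1, I2)"
    by (auto simp: gauge_orbit_def)
  have "fst (torus_act A1 A2 ?t (B, I1, I2)) a = u \<cdot>\<^sub>m B a"
    using a t by (simp add: torus_act_def)
  moreover have "fst (gauge_act g (B, I1, I2)) a = g * B a * mat_adjoint g"
    using a by (simp add: gauge_act_def)
  ultimately have "u \<cdot>\<^sub>m B a = g * B a * mat_adjoint g"
    using eq by simp
  then show "\<exists>g\<in>unitary_group k. u \<cdot>\<^sub>m B a = g * B a * mat_adjoint g"
    using g by blast
qed

section \<open>The norm bound at torus-fixed solutions\<close>

definition adhm_norm_sq :: "adhm \<Rightarrow> real" where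
  "adhm_norm_sq = (\<lambda>(B, I1, I2).
     (\<Sum>a\<in>{1..4}. frobenius_sq (B a)) + frobenius_sq I1 + frobenius_sq I2)"

lemma torus_fixed_bounded:
  assumes zeta: "0 \<le> \<zeta>" and x: "x \<in> adhm_solutions A1 A2 k r s \<zeta>"
    and fixed: "gauge_orbit k x \<in> torus_fixed_moduli A1 A2 k r s \<zeta>"
  shows "adhm_norm_sq x \<le> (\<zeta> + 2 * nilpotent_bound 4 \<zeta> (4 * k)) * k"
proof -
  obtain B I1 I2 where xB: "x = (B, I1, I2)" by (rule prod_cases3)
  note sol = x[unfolded xB]
  have data: "(B, I1, I2) \<in> adhm_data k r s"
    using sol adhm_solutions_data by blast
  note c = adhm_data_carrier[OF data]
  have sum1: "(\<Sum>a\<in>{1..4}. frobenius_sq (B a * 1\<^sub>m k)) = (\<Sum>a\<in>{1..4}. frobenius_sq (B a))"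
    by (intro sum.cong refl arg_cong[where f = frobenius_sq] right_mult_one_mat[OF c(1)])
  \<comment> \<open>With \<open>w = 1\<^sub>m k\<close> all four exponents are \<open>k\<close>, so
    their sum is \<open>4 * k\<close>; the final factor is \<open>k\<close>, the squared norm of the
    identity.\<close>
  have "(\<Sum>a\<in>{1..4}. frobenius_sq (B a * 1\<^sub>m k))
      \<le> nilpotent_bound (card {1..4::nat}) \<zeta> (\<Sum>a\<in>{1..4::nat}. k) * frobenius_sq (1\<^sub>m k)"
  proof (rule commuting_nilpotent_frobenius_bound[OF _ c(1)])
    fix w :: "complex mat" assume "w \<in> carrier_mat k k"
    from moment_map_frobenius[OF sol this]
    show "(\<Sum>a\<in>{1..4}. frobenius_sq (mat_adjoint (B a) * w))
      \<le> \<zeta> * frobenius_sq w + (\<Sum>a\<in>{1..4}. frobenius_sq (B a * w))"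
      using frobenius_sq_nonneg[of "mat_adjoint I1 * w"] frobenius_sq_nonneg[of "mat_adjoint I2 * w"]
      by linarith
  next
    fix a :: nat assume "a \<in> {1..4}"
    then show "B a ^\<^sub>m k * 1\<^sub>m k = 0\<^sub>m k k"
      using torus_fixed_nilpotent[OF data fixed[unfolded xB]] by simp
  qed (use zeta adhm_solutions_commute[OF sol] in auto)
  then have *: "(\<Sum>a\<in>{1..4}. frobenius_sq (B a)) \<le> nilpotent_bound 4 \<zeta> (4 * k) * k"
    unfolding sum1 by simp
  \<comment> \<open>At the same \<open>w\<close>, dropping the nonnegative sum over the adjoints
    bounds the framing part by \<open>\<zeta> * k\<close> plus the squared norms of the
    \<open>B a\<close>, whence the factor 2 in the claim.\<close>
  have "(\<Sum>a\<in>{1..4}. frobenius_sq (mat_adjoint (B a) * 1\<^sub>m k))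
      + frobenius_sq (mat_adjoint I1 * 1\<^sub>m k) + frobenius_sq (mat_adjoint I2 * 1\<^sub>m k)
    = \<zeta> * k + (\<Sum>a\<in>{1..4}. frobenius_sq (B a))"
    using moment_map_frobenius[OF sol one_carrier_mat] by (simp only: sum1 frobenius_sq_one)
  moreover have "mat_adjoint I1 * 1\<^sub>m k = mat_adjoint I1" "mat_adjoint I2 * 1\<^sub>m k = mat_adjoint I2"
    using c(2,3) by (auto intro!: right_mult_one_mat)
  moreover have "(\<Sum>a\<in>{1..4}. frobenius_sq (mat_adjoint (B a) * 1\<^sub>m k)) \<ge> 0"
    by (intro sum_nonneg frobenius_sq_nonneg)
  ultimately have "frobenius_sq I1 + frobenius_sq I2 \<le> \<zeta> * k + (\<Sum>a\<in>{1..4}. frobenius_sq (B a))"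
    by simp
  then show ?thesis
    using * unfolding xB adhm_norm_sq_def prod.case distrib_right by linarith
qed

section \<open>Bounded sets of orbits\<close>

lemma adhm_norm_sq_gauge_act:
  assumes g: "g \<in> unitary_group k" and x: "x \<in> adhm_data k r s"
  shows "adhm_norm_sq (gauge_act g x) = adhm_norm_sq x"
proof -
  obtain B I1 I2 where xB: "x = (B, I1, I2)" by (rule prod_cases3)
  note c = adhm_data_carrier[OF x[unfolded xB]]
  show ?thesis
    unfolding xB adhm_norm_sq_def gauge_act_def prod.case
    using frobenius_sq_conj_unitary[OF g c(1)] frobenius_sq_mult_unitary[OF g c(2)]
      frobenius_sq_mult_unitary[OF g c(3)] by simp
qed

section \<open>Norm balls of ADHM data are closed and compact\<close>

definition adhm_zero :: "nat \<Rightarrow> nat \<Rightarrow> nat \<Rightarrow> adhm" where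
  "adhm_zero k r s = (\<lambda>a\<in>{1..4}. 0\<^sub>m k k, 0\<^sub>m k r, 0\<^sub>m k s)"

lemma adhm_zero_data: "adhm_zero k r s \<in> adhm_data k r s"
  by (auto simp: adhm_zero_def adhm_data_def)

lemma frobenius_dist_zero:
  "A \<in> carrier_mat n m \<Longrightarrow> (frobenius_dist n m (0\<^sub>m n m) A)\<^sup>2 = frobenius_sq A"
  unfolding frobenius_sq_eq_L2_set frobenius_dist_def
  by (intro arg_cong[where f = power2] L2_set_cong) auto

lemma adhm_dist_zero:
  assumes "x \<in> adhm_data k r s"
  shows "adhm_dist k r s (adhm_zero k r s) x = sqrt (adhm_norm_sq x)"
proof -
  obtain B I1 I2 where xB: "x = (B, I1, I2)" by (rule prod_cases3)
  note c = adhm_data_carrier[OF assms[unfolded xB]]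
  show ?thesis
    unfolding xB adhm_norm_sq_def adhm_dist_def adhm_zero_def prod.case
    using c by (simp add: frobenius_dist_zero)
qed

lemma adhm_norm_ball_eq_mcball:
  assumes "0 \<le> R"
  shows "{x \<in> adhm_data k r s. adhm_norm_sq x \<le> R} =
    Metric_space.mcball (adhm_data k r s) (adhm_dist k r s) (adhm_zero k r s) (sqrt R)"
  using assms adhm_zero_data
  by (auto simp: Metric_space.in_mcball[OF Metric_space_adhm] adhm_dist_zero)

lemma closedin_adhm_norm_ball:
  assumes "0 \<le> R"
  shows "closedin (adhm_topology k r s) {x \<in> adhm_data k r s. adhm_norm_sq x \<le> R}"
  unfolding adhm_norm_ball_eq_mcball[OF assms] adhm_topology_def
  by (rule Metric_space.closedin_mcball[OF Metric_space_adhm])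

text \<open>The slots \<open>1..4\<close> of the first index hold the \<open>B\<^sub>a\<close>; the slots 0 and 5 hold \<open>I1\<close> and \<open>I2\<close>.\<close>

definition adhm_of_coords :: "nat \<Rightarrow> nat \<Rightarrow> nat \<Rightarrow> (nat \<times> nat \<times> nat \<Rightarrow> complex) \<Rightarrow> adhm" where
  "adhm_of_coords k r s f = (\<lambda>a\<in>{1..4}. mat k k (\<lambda>ij. f (a, ij)),
     mat k r (\<lambda>ij. f (0, ij)), mat k s (\<lambda>ij. f (5, ij)))"

lemma adhm_of_coords_data: "adhm_of_coords k r s f \<in> adhm_data k r s"
  by (auto simp: adhm_of_coords_def adhm_data_def)

text \<open>The distance from \<open>x\<close> depends continuously on finitely many coordinates.
  This makes preimages of metric balls open.\<close>

lemma continuous_on_adhm_dist_coords: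
  "continuous_on UNIV (\<lambda>f. adhm_dist k r s x (adhm_of_coords k r s f))"
proof -
  have fd: "(frobenius_dist n m X (mat n m g))\<^sup>2 =
      (\<Sum>ij\<in>{..<n} \<times> {..<m}. (cmod (X $$ ij - g ij))\<^sup>2)" for n m X g
    unfolding frobenius_dist_def L2_set_def
    by (subst real_sqrt_pow2) (auto intro!: sum_nonneg sum.cong)
  obtain B I1 I2 where x: "x = (B, I1, I2)" by (rule prod_cases3)
  have "adhm_dist k r s x (adhm_of_coords k r s f) =
      sqrt ((\<Sum>a\<in>{1..4}. \<Sum>ij\<in>{..<k} \<times> {..<k}. (cmod (B a $$ ij - f (a, ij)))\<^sup>2)
        + (\<Sum>ij\<in>{..<k} \<times> {..<r}. (cmod (I1 $$ ij - f (0, ij)))\<^sup>2)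
        + (\<Sum>ij\<in>{..<k} \<times> {..<s}. (cmod (I2 $$ ij - f (5, ij)))\<^sup>2))" for f
    by (simp add: x adhm_dist_def adhm_of_coords_def fd)
  then show ?thesis
    by (simp only:) (intro continuous_intros continuous_on_product_coordinates)
qed

lemma continuous_map_adhm_of_coords:
  "continuous_map euclidean (adhm_topology k r s) (adhm_of_coords k r s)"
  unfolding adhm_topology_def Metric_space.continuous_map_to_metric[OF Metric_space_adhm]
proof (intro ballI allI impI)
  fix f :: "nat \<times> nat \<times> nat \<Rightarrow> complex" and \<epsilon> :: real assume e: "0 < \<epsilon>"
  let ?\<Phi> = "adhm_of_coords k r s"
  let ?U = "{h. adhm_dist k r s (?\<Phi> f) (?\<Phi> h) < \<epsilon>}"
  have "open ?U"
    by (intro open_Collect_less continuous_on_adhm_dist_coords continuous_intros)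
  moreover have "f \<in> ?U"
    using e Metric_space.mdist_zero[OF Metric_space_adhm adhm_of_coords_data] by simp
  moreover have "\<forall>h\<in>?U. ?\<Phi> h \<in> Metric_space.mball (adhm_data k r s) (adhm_dist k r s) (?\<Phi> f) \<epsilon>"
    by (simp add: Metric_space.in_mball[OF Metric_space_adhm] adhm_of_coords_data)
  ultimately show "\<exists>U. openin euclidean U \<and> f \<in> U \<and>
      (\<forall>h\<in>U. ?\<Phi> h \<in> Metric_space.mball (adhm_data k r s) (adhm_dist k r s) (?\<Phi> f) \<epsilon>)"
    by (metis open_openin)
qed

lemma index_le_frobenius_sq:
  assumes "A \<in> carrier_mat n m" "i < n" "j < m"
  shows "(cmod (A $$ (i, j)))\<^sup>2 \<le> frobenius_sq A"
proof -
  have "(cmod (A $$ (i, j)))\<^sup>2 \<le> (\<Sum>j<dim_col A. (cmod (A $$ (i, j)))\<^sup>2)"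
    using assms by (intro member_le_sum) auto
  also have "\<dots> \<le> frobenius_sq A"
    unfolding frobenius_sq_def using assms
    by (intro member_le_sum[where f = "\<lambda>i. \<Sum>j<dim_col A. (cmod (A $$ (i, j)))\<^sup>2"]) (auto intro: sum_nonneg)
  finally show ?thesis .
qed

text \<open>A Heine-Borel argument: a product of closed discs is compact by Tychonoff, its image
  under \<open>adhm_of_coords\<close> contains the ball, and the ball is closed.\<close>

lemma compactin_adhm_norm_ball:
  assumes R: "0 \<le> R"
  shows "compactin (adhm_topology k r s) {x \<in> adhm_data k r s. adhm_norm_sq x \<le> R}"
proof (rule closed_compactin[OF _ _ closedin_adhm_norm_ball[OF R]])
  let ?C = "PiE UNIV (\<lambda>_. cball 0 (sqrt R)) :: (nat \<times> nat \<times> nat \<Rightarrow> complex) set"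
  have "compactin euclidean ?C"
    unfolding euclidean_product_topology[symmetric] compactin_PiE by simp
  then show "compactin (adhm_topology k r s) (adhm_of_coords k r s ` ?C)"
    by (rule image_compactin[OF _ continuous_map_adhm_of_coords])
  show "{x \<in> adhm_data k r s. adhm_norm_sq x \<le> R} \<subseteq> adhm_of_coords k r s ` ?C"
  proof (clarify)
    fix B I1 I2 assume x: "(B, I1, I2) \<in> adhm_data k r s" and le: "adhm_norm_sq (B, I1, I2) \<le> R"
    note c = adhm_data_carrier[OF x]
    \<comment> \<open>Coordinates outside the matrix ranges are set to 0, which lies in the disc;
      \<open>adhm_of_coords\<close> ignores them.\<close>
    define f where "f = (\<lambda>(a, i, j).
      if a = 0 then if i < k \<and> j < r then I1 $$ (i, j) else 0
      else if a = 5 then if i < k \<and> j < s then I2 $$ (i, j) else 0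
      else if a \<in> {1..4} \<and> i < k \<and> j < k then B a $$ (i, j) else 0)"
    have nn: "0 \<le> (\<Sum>a\<in>{1..4::nat}. frobenius_sq (B a))"
      by (intro sum_nonneg frobenius_sq_nonneg)
    have leI: "frobenius_sq I1 \<le> R" "frobenius_sq I2 \<le> R" "(\<Sum>a\<in>{1..4}. frobenius_sq (B a)) \<le> R"
      using le nn frobenius_sq_nonneg[of I1] frobenius_sq_nonneg[of I2]
      unfolding adhm_norm_sq_def prod.case by linarith+
    have leB: "frobenius_sq (B a) \<le> R" if "a \<in> {1..4}" for a
      by (rule order_trans[OF _ leI(3)], rule member_le_sum[OF that])
        (simp_all add: frobenius_sq_nonneg)
    have "(cmod (I1 $$ (i, j)))\<^sup>2 \<le> R" if "i < k" "j < r" for i j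
      by (rule order_trans[OF index_le_frobenius_sq[OF c(2) that] leI(1)])
    moreover have "(cmod (I2 $$ (i, j)))\<^sup>2 \<le> R" if "i < k" "j < s" for i j
      by (rule order_trans[OF index_le_frobenius_sq[OF c(3) that] leI(2)])
    moreover have "(cmod (B a $$ (i, j)))\<^sup>2 \<le> R" if "a \<in> {1..4}" "i < k" "j < k" for a i j
      by (rule order_trans[OF index_le_frobenius_sq[OF c(1)[OF that(1)] that(2,3)] leB[OF that(1)]])
    ultimately have sq: "(cmod (f (a, i, j)))\<^sup>2 \<le> R" for a i j
      using R by (simp add: f_def)
    have "cmod (f p) \<le> sqrt R" for p
      by (cases p) (simp add: real_le_rsqrt sq)
    then have "f \<in> ?C" by auto
    moreover have "(B, I1, I2) = adhm_of_coords k r s f"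
    proof -
      have "(\<lambda>a\<in>{1..4}. mat k k (\<lambda>ij. f (a, ij))) a = B a" for a
      proof (cases "a \<in> {1..4}")
        case True
        then show ?thesis using c(1)[OF True] by (auto simp: f_def intro!: eq_matI)
      next
        case False
        then show ?thesis using x by (auto simp: adhm_data_def)
      qed
      then show ?thesis
        using c(2,3) by (auto simp: adhm_of_coords_def f_def intro!: eq_matI)
    qed
    ultimately show "(B, I1, I2) \<in> adhm_of_coords k r s ` ?C" by blast
  qed
qed

text \<open>Gauge invariance of the norm makes the ball a union of orbits, so the ball is the full
  preimage of its image.\<close>

lemma gauge_orbit_norm_ball:
  assumes "x \<in> adhm_data k r s"
  shows "gauge_orbit k x \<in> gauge_orbit k ` {x \<in> adhm_data k r s. adhm_norm_sq x \<le> R}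
    \<longleftrightarrow> adhm_norm_sq x \<le> R"
proof
  assume "gauge_orbit k x \<in> gauge_orbit k ` {x \<in> adhm_data k r s. adhm_norm_sq x \<le> R}"
  then obtain y where y: "y \<in> adhm_data k r s" "adhm_norm_sq y \<le> R" "gauge_orbit k x = gauge_orbit k y"
    by auto
  then obtain g where "g \<in> unitary_group k" "x = gauge_act g y"
    using mem_gauge_orbit[OF assms] by (auto simp: gauge_orbit_def)
  then show "adhm_norm_sq x \<le> R"
    using adhm_norm_sq_gauge_act y by simp
qed (use assms in auto)

theorem propositionB27:
  fixes A1 A2 :: "nat set" and r1 r2 k :: nat and \<zeta> :: real
  assumes "A1 \<in> triples" and "A2 \<in> triples" and "A1 \<noteq> A2" and "\<zeta> > 0"
  shows "compactin (orbit_topology k r1 r2)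
           (orbit_topology k r1 r2 closure_of torus_fixed_moduli A1 A2 k r1 r2 \<zeta>)"
proof -
  define R where "R = (\<zeta> + 2 * nilpotent_bound 4 \<zeta> (4 * k)) * k"
  have R: "0 \<le> R"
    using \<open>\<zeta> > 0\<close> by (simp add: R_def nilpotent_bound_nonneg)
  let ?K = "{x \<in> adhm_data k r1 r2. adhm_norm_sq x \<le> R}"
  have "compactin (orbit_topology k r1 r2) (gauge_orbit k ` ?K)"
    using compactin_adhm_norm_ball[OF R] quotient_imp_continuous_map[OF quotient_map_gauge_orbit]
    by (rule image_compactin)
  \<comment> \<open>Under a quotient map a set is closed when its preimage is, and the preimage here
    is the closed ball itself.\<close>
  moreover have "closedin (orbit_topology k r1 r2) (gauge_orbit k ` ?K)"
  proof -
    have "{x \<in> adhm_data k r1 r2. gauge_orbit k x \<in> gauge_orbit k ` ?K} = ?K"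
      using gauge_orbit_norm_ball by blast
    then have "closedin (adhm_topology k r1 r2)
        {x \<in> topspace (adhm_topology k r1 r2). gauge_orbit k x \<in> gauge_orbit k ` ?K}"
      using closedin_adhm_norm_ball[OF R] by (simp add: topspace_adhm_topology)
    moreover have "gauge_orbit k ` ?K \<subseteq> topspace (orbit_topology k r1 r2)"
      by (auto simp: topspace_orbit_topology)
    ultimately show ?thesis
      using quotient_map_gauge_orbit[of k r1 r2] unfolding quotient_map_closedin by blast
  qed
  moreover have "torus_fixed_moduli A1 A2 k r1 r2 \<zeta> \<subseteq> gauge_orbit k ` ?K"
  proof
    fix p assume p: "p \<in> torus_fixed_moduli A1 A2 k r1 r2 \<zeta>"
    then obtain x where x: "x \<in> adhm_solutions A1 A2 k r1 r2 \<zeta>" "p = gauge_orbit k x"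
      by (auto simp: torus_fixed_moduli_def moduli_space_def)
    then have "adhm_norm_sq x \<le> R"
      using torus_fixed_bounded[OF _ x(1)] p \<open>\<zeta> > 0\<close> by (simp add: R_def)
    then show "p \<in> gauge_orbit k ` ?K"
      using x adhm_solutions_data by blast
  qed
  \<comment> \<open>The closure is the least closed superset, so it is a closed subset of the
    compact image.\<close>
  ultimately show ?thesis
    by (intro closed_compactin[OF _ _ closedin_closure_of] closure_of_minimal)
qed

end
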